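(* For each $R>0$ there exists a graph $G_R$ of maximum degree at most $3$ such that $\operatorname{re}(G_R)>R$.
   Context: Graphs are simple, undirected, finite, with at least one edge. A (planar) representation of a graph $G=(V,E)$ is a function $\rho:V\to\mathbb{R}^2$; $d$ denotes Euclidean distance; $\rho$ is non-vertex-degenerate (NVD) if it is injective. $V_2(G)$ is the set of 2-element subsets of $V$. Define $\operatorname{re}(G)=\min_\rho \frac{\max_{uv\in E}d(\rho(u),\rho(v))}{\min_{uv\in V_2(G)}d(\rho(u),\rho(v))}$ over NVD representations $\rho$. *)

theory Defs
  imports "HOL-Analysis.Analysis"
begin

definition two_subsets :: "'a set \<Rightarrow> 'a set set" where
  "two_subsets V = {e. e \<subseteq> V \<and> card e = 2}"

text \<open>Graphs are finite, simple and undirected, with at least one edge.\<close>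

definition graph :: "'a set \<Rightarrow> 'a set set \<Rightarrow> bool" where
  "graph V E \<longleftrightarrow> finite V \<and> E \<subseteq> two_subsets V \<and> E \<noteq> {}"

definition degree :: "'a set set \<Rightarrow> 'a \<Rightarrow> nat" where
  "degree E v = card {e \<in> E. v \<in> e}"

definition max_degree :: "'a set \<Rightarrow> 'a set set \<Rightarrow> nat" where
  "max_degree V E = Max (degree E ` V)"

text \<open>Representations are total functions on the vertex type; only their values on the
  vertex set are ever used.\<close>

definition nvd :: "'a set \<Rightarrow> ('a \<Rightarrow> real ^ 2) \<Rightarrow> bool" where
  "nvd V \<rho> \<longleftrightarrow> inj_on \<rho> V"

definition pair_dists :: "('a \<Rightarrow> real ^ 2) \<Rightarrow> 'a set set \<Rightarrow> real set" where
  "pair_dists \<rho> F = {dist (\<rho> u) (\<rho> v) | u v. {u, v} \<in> F}"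

definition dist_ratio :: "'a set \<Rightarrow> 'a set set \<Rightarrow> ('a \<Rightarrow> real ^ 2) \<Rightarrow> real" where
  "dist_ratio V E \<rho> = Max (pair_dists \<rho> E) / Min (pair_dists \<rho> (two_subsets V))"

text \<open>The infimum below is a minimum for every graph, see \<open>re_attained\<close> and \<open>re_le\<close>.\<close>

definition re :: "'a set \<Rightarrow> 'a set set \<Rightarrow> real" where
  "re V E = (INF \<rho> \<in> {\<rho>. nvd V \<rho>}. dist_ratio V E \<rho>)"

lemma pair_dists_image: "pair_dists \<rho> F = (\<lambda>(u, v). dist (\<rho> u) (\<rho> v)) ` {(u, v). {u, v} \<in> F}"
  by (auto simp: pair_dists_def)

lemma finite_ordered_pairs:
  assumes "finite V" "F \<subseteq> two_subsets V"
  shows "finite {(u, v). {u, v} \<in> F}"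
  by (rule finite_subset[of _ "V \<times> V"]) (use assms in \<open>auto simp: two_subsets_def\<close>)

lemma finite_pair_dists:
  assumes "finite V" "F \<subseteq> two_subsets V"
  shows "finite (pair_dists \<rho> F)"
  unfolding pair_dists_image by (intro finite_imageI finite_ordered_pairs[OF assms])

lemma ordered_pairs_nonempty:
  assumes "F \<subseteq> two_subsets V" "F \<noteq> {}"
  shows "{(u, v). {u, v} \<in> F} \<noteq> {}"
proof -
  obtain e where e: "e \<in> F" using assms by blast
  then have "card e = 2" using assms by (auto simp: two_subsets_def)
  then obtain u v where "e = {u, v}" by (auto simp: card_2_iff)
  then show ?thesis using e by blast
qed

lemma pair_dists_nonempty:
  assumes "F \<subseteq> two_subsets V" "F \<noteq> {}"
  shows "pair_dists \<rho> F \<noteq> {}"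
  unfolding pair_dists_image using ordered_pairs_nonempty[OF assms] by simp

lemma doubleton_two_subsets: "{u, v} \<in> two_subsets V \<longleftrightarrow> u \<in> V \<and> v \<in> V \<and> u \<noteq> v"
  by (auto simp: two_subsets_def card_2_iff doubleton_eq_iff)

lemma squeeze_line:
  fixes X :: "real set"
  assumes "finite X"
  shows "\<exists>f. (\<forall>x\<in>X. 0 \<le> f x \<and> f x \<le> real (card X)) \<and>
    (\<forall>x\<in>X. \<forall>y\<in>X. x \<le> y \<longrightarrow> f y - f x \<le> y - x \<and> min 1 (y - x) \<le> f y - f x)"
  using assms
proof (induction rule: finite_linorder_max_induct)
  case empty
  then show ?case by simp
next
  case (insert b A)
  then obtain f where f0: "\<And>x. x \<in> A \<Longrightarrow> 0 \<le> f x \<and> f x \<le> real (card A)"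
    and f1: "\<And>x y. x \<in> A \<Longrightarrow> y \<in> A \<Longrightarrow> x \<le> y \<Longrightarrow> f y - f x \<le> y - x \<and> min 1 (y - x) \<le> f y - f x"
    by blast
  have bA: "b \<notin> A" using insert by auto
  show ?case
  proof (cases "A = {}")
    case True
    then show ?thesis by (intro exI[of _ "\<lambda>_. 0"]) auto
  next
    case False
    define m where "m = Max A"
    have m: "m \<in> A" "\<And>x. x \<in> A \<Longrightarrow> x \<le> m" "m < b"
      using False insert by (auto simp: m_def)
    define g where "g = f(b := f m + min 1 (b - m))"
    have gb: "g b = f m + min 1 (b - m)" and gA: "\<And>x. x \<in> A \<Longrightarrow> g x = f x"
      using bA by (auto simp: g_def)
    have c: "real (card (insert b A)) = real (card A) + 1"
      using bA insert by simp
    have bnd: "0 \<le> g x \<and> g x \<le> real (card (insert b A))" if "x \<in> insert b A" for x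
    proof (cases "x = b")
      case True
      then show ?thesis using f0[OF m(1)] m(3) gb unfolding c by (auto simp: min_def)
    next
      case False
      then have "x \<in> A" using that by auto
      then show ?thesis using f0 gA unfolding c by fastforce
    qed
    have lip: "g y - g x \<le> y - x \<and> min 1 (y - x) \<le> g y - g x"
      if "x \<in> insert b A" "y \<in> insert b A" "x \<le> y" for x y
    proof (cases "y = b")
      case True
      show ?thesis
      proof (cases "x = b")
        case False
        then have x: "x \<in> A" using that by auto
        show ?thesis
          using f1[OF x m(1) m(2)[OF x]] m(2)[OF x] m(3)
          unfolding \<open>y = b\<close> gb gA[OF x] by (auto simp: min_def split: if_splits)
      qed (use True in auto)
    next
      case False
      then have y: "y \<in> A" using that by auto
      then have "x \<noteq> b" using that insert by force
      then have "x \<in> A" using that by auto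
      then show ?thesis using f1 y that gA by auto
    qed
    show ?thesis using bnd lip by blast
  qed
qed

lemma squeeze_plane:
  fixes \<rho> :: "'a \<Rightarrow> real ^ 2"
  assumes "finite V" and sep: "\<And>u v. u \<in> V \<Longrightarrow> v \<in> V \<Longrightarrow> u \<noteq> v \<Longrightarrow> 1 \<le> dist (\<rho> u) (\<rho> v)"
  shows "\<exists>\<sigma> :: 'a \<Rightarrow> real ^ 2. (\<forall>v. v \<notin> V \<longrightarrow> \<sigma> v = 0) \<and>
    (\<forall>v\<in>V. \<sigma> v \<in> cbox 0 (\<chi> i. real (card V))) \<and>
    (\<forall>u\<in>V. \<forall>v\<in>V. dist (\<sigma> u) (\<sigma> v) \<le> dist (\<rho> u) (\<rho> v)) \<and>
    (\<forall>u\<in>V. \<forall>v\<in>V. u \<noteq> v \<longrightarrow> 1 \<le> dist (\<sigma> u) (\<sigma> v))"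
proof -
  define Q where "Q i f \<longleftrightarrow>
    (\<forall>x\<in>(\<lambda>v. \<rho> v $ i) ` V. 0 \<le> f x \<and> f x \<le> real (card V)) \<and>
    (\<forall>x\<in>(\<lambda>v. \<rho> v $ i) ` V. \<forall>y\<in>(\<lambda>v. \<rho> v $ i) ` V.
      x \<le> y \<longrightarrow> f y - f x \<le> y - x \<and> min 1 (y - x) \<le> f y - f x)" for i f
  have "\<forall>i. \<exists>f. Q i f"
  proof
    fix i
    have le: "real (card ((\<lambda>v. \<rho> v $ i) ` V)) \<le> real (card V)"
      using card_image_le[OF assms(1)] by simp
    show "\<exists>f. Q i f"
      using squeeze_line[OF finite_imageI[OF assms(1)], of "\<lambda>v. \<rho> v $ i"]
    proof (elim exE conjE)
      fix f
      assume f: "\<forall>x\<in>(\<lambda>v. \<rho> v $ i) ` V. 0 \<le> f x \<and> f x \<le> real (card ((\<lambda>v. \<rho> v $ i) ` V))"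
        "\<forall>x\<in>(\<lambda>v. \<rho> v $ i) ` V. \<forall>y\<in>(\<lambda>v. \<rho> v $ i) ` V.
          x \<le> y \<longrightarrow> f y - f x \<le> y - x \<and> min 1 (y - x) \<le> f y - f x"
      have "Q i f"
        unfolding Q_def by (intro conjI f(2)) (use f(1) le in fastforce)
      then show ?thesis by (rule exI[of "Q i"])
    qed
  qed
  then obtain f where f: "\<And>i. Q i (f i)"
    using choice[of Q] by blast
  define \<sigma> :: "'a \<Rightarrow> real ^ 2"
    where "\<sigma> v = (if v \<in> V then (\<chi> i. f i (\<rho> v $ i)) else 0)" for v
  have \<sigma>V: "\<sigma> v $ i = f i (\<rho> v $ i)" if "v \<in> V" for v i
    using that by (simp add: \<sigma>_def)
  have bnd: "\<sigma> v \<in> cbox 0 (\<chi> i. real (card V))" if "v \<in> V" for v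
    using f that by (auto simp: Q_def mem_box_cart \<sigma>V)
  have comp: "dist (\<sigma> u $ i) (\<sigma> v $ i) \<le> dist (\<rho> u $ i) (\<rho> v $ i) \<and>
      min 1 (dist (\<rho> u $ i) (\<rho> v $ i)) \<le> dist (\<sigma> u $ i) (\<sigma> v $ i)"
    if uv: "u \<in> V" "v \<in> V" for u v i
  proof -
    have ord: "dist (\<sigma> u $ i) (\<sigma> v $ i) \<le> dist (\<rho> u $ i) (\<rho> v $ i) \<and>
      min 1 (dist (\<rho> u $ i) (\<rho> v $ i)) \<le> dist (\<sigma> u $ i) (\<sigma> v $ i)"
      if "u \<in> V" "v \<in> V" "\<rho> u $ i \<le> \<rho> v $ i" for u v
    proof -
      have "f i (\<rho> v $ i) - f i (\<rho> u $ i) \<le> \<rho> v $ i - \<rho> u $ i \<and>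
        min 1 (\<rho> v $ i - \<rho> u $ i) \<le> f i (\<rho> v $ i) - f i (\<rho> u $ i)"
        using f[of i] that unfolding Q_def by blast
      then show ?thesis
        using that by (auto simp: dist_real_def \<sigma>V min_def split: if_splits)
    qed
    show ?thesis
      using ord[OF uv] ord[OF uv(2,1)] by (metis dist_commute linear)
  qed
  have lip: "dist (\<sigma> u) (\<sigma> v) \<le> dist (\<rho> u) (\<rho> v)" if "u \<in> V" "v \<in> V" for u v
    unfolding dist_vec_def by (rule L2_set_mono) (use comp that in auto)
  have "1 \<le> dist (\<sigma> u) (\<sigma> v)" if uv: "u \<in> V" "v \<in> V" "u \<noteq> v" for u v
  proof (cases "\<exists>i. 1 \<le> dist (\<rho> u $ i) (\<rho> v $ i)")
    case True
    then obtain i where "1 \<le> dist (\<rho> u $ i) (\<rho> v $ i)" by blast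
    then have "1 \<le> dist (\<sigma> u $ i) (\<sigma> v $ i)" using comp[OF uv(1,2), of i] by auto
    also have "\<dots> \<le> dist (\<sigma> u) (\<sigma> v)" by (rule dist_vec_nth_le)
    finally show ?thesis .
  next
    case False
    then have "dist (\<rho> u $ i) (\<rho> v $ i) \<le> dist (\<sigma> u $ i) (\<sigma> v $ i)" for i
    proof -
      have "dist (\<rho> u $ i) (\<rho> v $ i) \<le> 1"
        using False by (meson linear)
      then show ?thesis
        using comp[OF uv(1,2), of i] by (simp only: min.absorb2)
    qed
    then have "dist (\<rho> u) (\<rho> v) \<le> dist (\<sigma> u) (\<sigma> v)"
      unfolding dist_vec_def by (intro L2_set_mono) auto
    then show ?thesis using sep[OF uv] by linarith
  qed
  then show ?thesis using bnd lip by (intro exI[of _ \<sigma>]) (auto simp: \<sigma>_def)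
qed

lemma continuous_on_Max_image:
  fixes f :: "'i \<Rightarrow> 'b::topological_space \<Rightarrow> real"
  assumes "finite A" "A \<noteq> {}" "\<And>a. a \<in> A \<Longrightarrow> continuous_on S (f a)"
  shows "continuous_on S (\<lambda>x. Max ((\<lambda>a. f a x) ` A))"
  using assms
proof (induction rule: finite_ne_induct)
  case (insert a A)
  then have "continuous_on S (\<lambda>x. max (f a x) (Max ((\<lambda>a. f a x) ` A)))"
    by (intro continuous_on_max) auto
  then show ?case using insert by simp
qed simp

lemma graph_two_subsets_nonempty: "graph V E \<Longrightarrow> two_subsets V \<noteq> {}"
  by (auto simp: graph_def)

lemma Min_pair_dists_pos:
  assumes "graph V E" "nvd V \<rho>"
  shows "0 < Min (pair_dists \<rho> (two_subsets V))"
proof -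
  have "finite (pair_dists \<rho> (two_subsets V))" "pair_dists \<rho> (two_subsets V) \<noteq> {}"
    using assms(1) graph_two_subsets_nonempty[OF assms(1)]
      finite_pair_dists[of V "two_subsets V"] pair_dists_nonempty[of "two_subsets V" V]
    by (simp_all add: graph_def)
  moreover have "0 < x" if "x \<in> pair_dists \<rho> (two_subsets V)" for x
    using that assms(2) by (auto simp: pair_dists_def doubleton_two_subsets nvd_def inj_on_def)
  ultimately show ?thesis by simp
qed

lemma Max_pair_dists_nonneg:
  assumes "graph V E"
  shows "0 \<le> Max (pair_dists \<rho> E)"
proof -
  have "finite (pair_dists \<rho> E)" "pair_dists \<rho> E \<noteq> {}"
    using assms finite_pair_dists[of V E] pair_dists_nonempty[of E V] by (simp_all add: graph_def)
  then have "Max (pair_dists \<rho> E) \<in> pair_dists \<rho> E" by simp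
  then show ?thesis by (auto simp: pair_dists_def)
qed

lemma dist_ratio_minimum_exists:
  fixes V :: "'a set"
  assumes G: "graph V E"
  shows "\<exists>\<sigma>. nvd V \<sigma> \<and> (\<forall>\<rho>. nvd V \<rho> \<longrightarrow> dist_ratio V E \<sigma> \<le> dist_ratio V E \<rho>)"
proof -
  have fin: "finite V" and EV: "E \<subseteq> two_subsets V" and "E \<noteq> {}"
    using G by (auto simp: graph_def)
  define P where "P = {(u, v). {u, v} \<in> E}"
  have P: "finite P" "P \<noteq> {}"
    unfolding P_def by (rule finite_ordered_pairs[OF fin EV], rule ordered_pairs_nonempty[OF EV]) fact
  have PV: "u \<in> V" "v \<in> V" if "(u, v) \<in> P" for u v
    using that EV by (auto simp: P_def two_subsets_def)
  define B where "B v = (if v \<in> V then cbox 0 (\<chi> i. real (card V)) else {0 :: real ^ 2})" for v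
  define S where "S = PiE UNIV B \<inter> (\<Inter>u\<in>V. \<Inter>v\<in>V - {u}. {\<sigma>. 1 \<le> dist (\<sigma> u) (\<sigma> v)})"
  have memS: "\<sigma> \<in> S \<longleftrightarrow> (\<forall>v. \<sigma> v \<in> B v) \<and>
      (\<forall>u\<in>V. \<forall>v\<in>V. u \<noteq> v \<longrightarrow> 1 \<le> dist (\<sigma> u) (\<sigma> v))" for \<sigma>
    by (auto simp: S_def PiE_UNIV_domain)
  have "compactin (product_topology (\<lambda>_. euclidean) UNIV) (PiE UNIV B)"
    by (subst compactin_PiE) (auto simp: B_def)
  then have "compact (PiE UNIV B)"
    by (simp add: euclidean_product_topology)
  moreover have coord: "continuous_on X (\<lambda>\<sigma>. \<sigma> u)" for u :: 'a and X :: "('a \<Rightarrow> real ^ 2) set"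
    by (rule continuous_on_product_coordinates[THEN continuous_on_subset]) simp
  have "closed (\<Inter>u\<in>V. \<Inter>v\<in>V - {u}. {\<sigma> :: 'a \<Rightarrow> real ^ 2. 1 \<le> dist (\<sigma> u) (\<sigma> v)})"
    by (intro closed_INT ballI closed_Collect_le continuous_intros coord)
  ultimately have cS: "compact S" unfolding S_def by (rule compact_Int_closed)
  define g where "g \<sigma> = Max (pair_dists \<sigma> E)" for \<sigma> :: "'a \<Rightarrow> real ^ 2"
  have g_eq: "g \<sigma> = Max ((\<lambda>p. dist (\<sigma> (fst p)) (\<sigma> (snd p))) ` P)" for \<sigma>
    by (simp add: g_def pair_dists_image P_def case_prod_unfold)
  have cg: "continuous_on S g"
    unfolding g_eq
    by (intro continuous_on_Max_image P continuous_on_dist coord)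
  have reduce: "\<exists>\<sigma>\<in>S. g \<sigma> \<le> dist_ratio V E \<rho>" if \<rho>: "nvd V \<rho>" for \<rho>
  proof -
    define m where "m = Min (pair_dists \<rho> (two_subsets V))"
    have m: "0 < m" unfolding m_def by (rule Min_pair_dists_pos[OF G \<rho>])
    define \<tau> where "\<tau> v = (1 / m) *\<^sub>R \<rho> v" for v
    have d\<tau>: "dist (\<tau> u) (\<tau> v) = dist (\<rho> u) (\<rho> v) / m" for u v
      using m by (simp add: \<tau>_def dist_norm divide_inverse mult.commute flip: scaleR_diff_right)
    have "1 \<le> dist (\<tau> u) (\<tau> v)" if "u \<in> V" "v \<in> V" "u \<noteq> v" for u v
    proof -
      have "dist (\<rho> u) (\<rho> v) \<in> pair_dists \<rho> (two_subsets V)"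
        using that doubleton_two_subsets[of u v V] by (auto simp: pair_dists_def)
      then have "m \<le> dist (\<rho> u) (\<rho> v)"
        unfolding m_def by (intro Min_le finite_pair_dists[OF fin]) auto
      then show ?thesis using m by (simp add: d\<tau>)
    qed
    then have "\<exists>\<sigma> :: 'a \<Rightarrow> real ^ 2. (\<forall>v. v \<notin> V \<longrightarrow> \<sigma> v = 0) \<and>
        (\<forall>v\<in>V. \<sigma> v \<in> cbox 0 (\<chi> i. real (card V))) \<and>
        (\<forall>u\<in>V. \<forall>v\<in>V. dist (\<sigma> u) (\<sigma> v) \<le> dist (\<tau> u) (\<tau> v)) \<and>
        (\<forall>u\<in>V. \<forall>v\<in>V. u \<noteq> v \<longrightarrow> 1 \<le> dist (\<sigma> u) (\<sigma> v))"
      by (rule squeeze_plane[OF fin])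
    then obtain \<sigma> :: "'a \<Rightarrow> real ^ 2" where
      \<sigma>: "\<forall>v. v \<notin> V \<longrightarrow> \<sigma> v = 0" "\<forall>v\<in>V. \<sigma> v \<in> cbox 0 (\<chi> i. real (card V))"
        "\<forall>u\<in>V. \<forall>v\<in>V. dist (\<sigma> u) (\<sigma> v) \<le> dist (\<tau> u) (\<tau> v)"
        "\<forall>u\<in>V. \<forall>v\<in>V. u \<noteq> v \<longrightarrow> 1 \<le> dist (\<sigma> u) (\<sigma> v)"
      by (elim exE conjE)
    have "\<sigma> \<in> S" using \<sigma>(1,2,4) unfolding memS B_def by simp
    moreover have "g \<sigma> \<le> dist_ratio V E \<rho>"
      unfolding g_eq
    proof (subst Max_le_iff)
      show "\<forall>x\<in>(\<lambda>p. dist (\<sigma> (fst p)) (\<sigma> (snd p))) ` P. x \<le> dist_ratio V E \<rho>"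
      proof safe
        fix u v assume uv: "(u, v) \<in> P"
        have "dist (\<rho> u) (\<rho> v) \<in> pair_dists \<rho> E"
          using uv by (auto simp: P_def pair_dists_def)
        then have "dist (\<rho> u) (\<rho> v) \<le> Max (pair_dists \<rho> E)"
          by (intro Max_ge finite_pair_dists[OF fin EV])
        then have "dist (\<tau> u) (\<tau> v) \<le> dist_ratio V E \<rho>"
          unfolding d\<tau> dist_ratio_def m_def[symmetric] using m by (simp add: divide_right_mono)
        then show "dist (\<sigma> (fst (u, v))) (\<sigma> (snd (u, v))) \<le> dist_ratio V E \<rho>"
          using \<sigma>(3) PV[OF uv] by fastforce
      qed
    qed (use P in auto)
    ultimately show ?thesis by blast
  qed
  obtain h :: "'a \<Rightarrow> nat" where h: "inj_on h V"
    using finite_imp_inj_to_nat_seg[OF fin] by blast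
  have "nvd V (\<lambda>v. \<chi> i. real (h v))"
    using h by (auto simp: nvd_def inj_on_def vec_eq_iff)
  then have "S \<noteq> {}" using reduce by blast
  then obtain \<sigma> where \<sigma>: "\<sigma> \<in> S" "\<And>\<tau>. \<tau> \<in> S \<Longrightarrow> g \<sigma> \<le> g \<tau>"
    using continuous_attains_inf[OF cS _ cg] by blast
  have inj: "nvd V \<sigma>"
    using \<sigma>(1) unfolding memS nvd_def inj_on_def by fastforce
  have "1 \<le> Min (pair_dists \<sigma> (two_subsets V))"
  proof (subst Min_ge_iff)
    show "\<forall>a\<in>pair_dists \<sigma> (two_subsets V). 1 \<le> a"
      using \<sigma>(1) by (auto simp: memS pair_dists_def doubleton_two_subsets)
  qed (use finite_pair_dists[OF fin order_refl] pair_dists_nonempty[OF order_refl]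
      graph_two_subsets_nonempty[OF G] in simp_all)
  then have "dist_ratio V E \<sigma> \<le> g \<sigma>"
    unfolding dist_ratio_def g_def[symmetric]
    using Max_pair_dists_nonneg[OF G, of \<sigma>] unfolding g_def[symmetric]
    by (simp add: divide_le_eq mult_le_cancel_left1)
  then show ?thesis
    using inj reduce \<sigma>(2) by (meson order_trans)
qed

lemma re_attained:
  assumes "graph V E"
  shows "\<exists>\<rho>. nvd V \<rho> \<and> re V E = dist_ratio V E \<rho>"
proof -
  obtain \<sigma> where \<sigma>: "nvd V \<sigma>" "\<And>\<rho>. nvd V \<rho> \<Longrightarrow> dist_ratio V E \<sigma> \<le> dist_ratio V E \<rho>"
    using dist_ratio_minimum_exists[OF assms] by blast
  have "re V E = dist_ratio V E \<sigma>"
    unfolding re_def by (rule cInf_eq_minimum) (use \<sigma> in auto)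
  then show ?thesis using \<sigma> by blast
qed

lemma re_le:
  assumes "graph V E" "nvd V \<rho>"
  shows "re V E \<le> dist_ratio V E \<rho>"
proof -
  have "bdd_below (dist_ratio V E ` {\<rho>. nvd V \<rho>})"
    using dist_ratio_minimum_exists[OF assms(1)] by (auto simp: bdd_below_def)
  then show ?thesis
    unfolding re_def using assms(2) by (intro cINF_lower) auto
qed

end

theory Submission
  imports Defs
begin

text \<open>
  A complete binary tree has maximum degree 3. If its points are pairwise at distance at least
  \<open>m\<close> and its edges have length at most \<open>R m\<close>, then all points of a tree with \<open>n\<close> levels lie within
  distance \<open>n R m\<close> of the root, so a packing argument bounds their number quadratically in \<open>n\<close>,
  whereas the tree has \<open>2 ^ n - 1\<close> vertices.
\<close>

text \<open>Pigeonhole on a square grid of mesh \<open>m / 2\<close> with a corner at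
  \<open>c\<close>: a cell holds at most one point. The factor 2 in the distance bound measures the
  radius in mesh units, so cell indices run from \<open>- K\<close> to \<open>K\<close> in each
  coordinate.\<close>

lemma card_separated_le:
  fixes p :: "'a \<Rightarrow> real ^ 2" and K :: nat
  assumes "0 < m"
    and sep: "\<And>u v. u \<in> V \<Longrightarrow> v \<in> V \<Longrightarrow> u \<noteq> v \<Longrightarrow> m \<le> dist (p u) (p v)"
    and near: "\<And>v. v \<in> V \<Longrightarrow> 2 * dist (p v) c \<le> real K * m"
  shows "card V \<le> (2 * K + 1)\<^sup>2"
proof -
  define q where "q v i = 2 * (p v $ i - c $ i) / m" for v i
  text \<open>Points in the same square cell of side \<open>m / 2\<close> are at distance less than \<open>m\<close>.\<close>
  define cell where "cell v = (\<lfloor>q v 1\<rfloor>, \<lfloor>q v 2\<rfloor>)" for v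
  have "inj_on cell V"
  proof (rule inj_onI, rule ccontr)
    fix u v assume uv: "u \<in> V" "v \<in> V" "cell u = cell v" "u \<noteq> v"
    have comp: "dist (p u $ i) (p v $ i) \<le> m / 2" if "\<lfloor>q u i\<rfloor> = \<lfloor>q v i\<rfloor>" for i
    proof -
      have "\<bar>q u i - q v i\<bar> \<le> 1"
        using that by linarith
      moreover have "q u i - q v i = (2 * p u $ i - 2 * p v $ i) / m"
        by (simp add: q_def diff_divide_distrib algebra_simps)
      ultimately have "\<bar>2 * p u $ i - 2 * p v $ i\<bar> \<le> m"
        using \<open>0 < m\<close> by (simp add: divide_le_eq)
      then show ?thesis unfolding dist_real_def by linarith
    qed
    have "(dist (p u) (p v))\<^sup>2 = (dist (p u $ 1) (p v $ 1))\<^sup>2 + (dist (p u $ 2) (p v $ 2))\<^sup>2"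
      by (simp add: dist_vec_def L2_set_def sum_2)
    also have "\<dots> \<le> (m / 2)\<^sup>2 + (m / 2)\<^sup>2"
      using uv(3) by (intro add_mono power_mono comp) (auto simp: cell_def)
    also have "\<dots> < m\<^sup>2"
      using \<open>0 < m\<close> by (simp add: power2_eq_square)
    finally have "dist (p u) (p v) < m"
      using \<open>0 < m\<close> by (simp add: power_less_imp_less_base)
    then show False using sep uv by fastforce
  qed
  moreover have "cell ` V \<subseteq> {- int K..int K} \<times> {- int K..int K}"
  proof -
    have "\<lfloor>q v i\<rfloor> \<in> {- int K..int K}" if "v \<in> V" for v i
    proof -
      have "dist (p v $ i) (c $ i) \<le> dist (p v) c"
        by (rule dist_vec_nth_le)
      then have "\<bar>2 * p v $ i - 2 * c $ i\<bar> \<le> real K * m"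
        using near[OF that] unfolding dist_real_def by linarith
      then have "\<bar>q v i\<bar> \<le> real K"
        using \<open>0 < m\<close> by (simp add: q_def abs_mult divide_le_eq)
      then have "- int K \<le> \<lfloor>q v i\<rfloor> \<and> \<lfloor>q v i\<rfloor> \<le> int K" by linarith
      then show ?thesis by simp
    qed
    then show ?thesis by (auto simp: cell_def)
  qed
  ultimately have "card V \<le> card ({- int K..int K} \<times> {- int K..int K})"
    by (intro card_inj_on_le) auto
  moreover have "card {- int K..int K} = 2 * K + 1" by simp
  ultimately show ?thesis
    by (simp only: card_cartesian_product power2_eq_square)
qed

text \<open>The complete binary tree with \<open>n\<close> levels in heap order: the children of \<open>k\<close> are
  \<open>2 * k\<close> and \<open>2 * k + 1\<close>.\<close>

definition tree_vertices :: "nat \<Rightarrow> nat set" where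
  "tree_vertices n = {1..<2 ^ n}"

definition tree_edges :: "nat \<Rightarrow> nat set set" where
  "tree_edges n = (\<lambda>k. {k, k div 2}) ` {2..<2 ^ n}"

lemma graph_tree:
  assumes "2 \<le> n"
  shows "graph (tree_vertices n) (tree_edges n)"
proof -
  \<comment> \<open>This puts 2 into \<open>{2..<2 ^ n}\<close>, so an edge exists; a single level
    would be the root alone.\<close>
  have "(2::nat) ^ 2 \<le> 2 ^ n"
    using assms by (intro power_increasing) auto
  then show ?thesis
    by (auto simp: graph_def tree_vertices_def tree_edges_def doubleton_two_subsets)
qed

lemma degree_tree_le: "degree (tree_edges n) v \<le> 3"
proof -
  \<comment> \<open>The candidates are the edge to the parent and those to the two children. Writing
    them as a list lets \<open>card_length\<close> give the bound 3 without deciding which of them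
    coincide.\<close>
  have "{e \<in> tree_edges n. v \<in> e} \<subseteq> set [{v, v div 2}, {2 * v, v}, {2 * v + 1, v}]"
  proof
    fix e assume "e \<in> {e \<in> tree_edges n. v \<in> e}"
    then obtain k where k: "e = {k, k div 2}" "v = k \<or> v = k div 2"
      by (auto simp: tree_edges_def)
    moreover have "k = 2 * (k div 2) \<or> k = 2 * (k div 2) + 1" by presburger
    ultimately show "e \<in> set [{v, v div 2}, {2 * v, v}, {2 * v + 1, v}]" by auto
  qed
  then have "degree (tree_edges n) v \<le> card (set [{v, v div 2}, {2 * v, v}, {2 * v + 1, v}])"
    unfolding degree_def by (intro card_mono) auto
  also have "\<dots> \<le> 3"
    by (rule order_trans[OF card_length]) simp
  finally show ?thesis .
qed

lemma max_degree_tree_le: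
  assumes "2 \<le> n"
  shows "max_degree (tree_vertices n) (tree_edges n) \<le> 3"
proof -
  have "1 < (2::nat) ^ n" using assms by (intro one_less_power) auto
  then have "tree_vertices n \<noteq> {}" by (auto simp: tree_vertices_def)
  moreover have "finite (tree_vertices n)" by (simp add: tree_vertices_def)
  ultimately show ?thesis
    by (simp add: max_degree_def degree_tree_le)
qed

text \<open>Halving \<open>v\<close> moves one level up, so the triangle inequality adds one edge
  length per level. The factor \<open>k - 1\<close> is the depth of the lowest of \<open>k\<close>
  levels.\<close>

lemma tree_dist_root_le:
  fixes p :: "nat \<Rightarrow> 'a::metric_space"
  assumes edge: "\<And>k. 2 \<le> k \<Longrightarrow> k < 2 ^ n \<Longrightarrow> dist (p k) (p (k div 2)) \<le> D"
    and "k \<le> n" "1 \<le> v" "v < 2 ^ k"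
  shows "dist (p v) (p 1) \<le> real (k - 1) * D"
  using assms(2-)
proof (induction k arbitrary: v)
  case (Suc k)
  have le: "(2::nat) ^ Suc k \<le> 2 ^ n"
    using Suc.prems by (intro power_increasing) auto
  \<comment> \<open>Needed at the root, where the left side is 0. The edge from 2 to 1 supplies the
    sign; for \<open>k = 0\<close> the factor of \<open>D\<close> vanishes.\<close>
  have "0 \<le> D" if "1 \<le> k"
  proof -
    have "2 < (2::nat) ^ n"
    proof -
      have "(2::nat) ^ 2 \<le> 2 ^ Suc k" using that by (intro power_increasing) auto
      then show ?thesis using le by simp
    qed
    then have "dist (p 2) (p (2 div 2)) \<le> D" by (intro edge) auto
    then show ?thesis using zero_le_dist[of "p 2" "p (2 div 2)"] by linarith
  qed
  show ?case
  proof (cases "v = 1")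
    case True
    then show ?thesis using \<open>1 \<le> k \<Longrightarrow> 0 \<le> D\<close> by (cases k) auto
  next
    case False
    then have v: "1 \<le> v div 2" "v div 2 < 2 ^ k" "2 \<le> v" "v < 2 ^ n"
      using Suc.prems le by auto
    \<comment> \<open>Excludes truncation in \<open>k - 1\<close>, so the two bounds add up to
      \<open>k * D\<close>.\<close>
    then have "1 \<le> k" by (cases k) auto
    have "dist (p v) (p 1) \<le> dist (p v) (p (v div 2)) + dist (p (v div 2)) (p 1)"
      by (rule dist_triangle)
    also have "\<dots> \<le> D + real (k - 1) * D"
      using Suc.IH[of "v div 2"] Suc.prems v edge by (intro add_mono) auto
    also have "\<dots> = real (Suc k - 1) * D"
      using \<open>1 \<le> k\<close> by (simp add: of_nat_diff algebra_simps)
    finally show ?thesis .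
  qed
qed simp

text \<open>Since the minimum is attained, \<open>re\<close> is the ratio \<open>D / m\<close> of
  one representation. Every vertex is then within \<open>n * D\<close> of the root, and the packing
  bound applies with centre \<open>p 1\<close> and radius \<open>n * K\<close> in units of
  \<open>m / 2\<close>.\<close>

lemma re_tree_card_bound:
  fixes K :: nat
  assumes "2 \<le> n" "2 * re (tree_vertices n) (tree_edges n) \<le> real K"
  shows "2 ^ n - 1 \<le> (2 * (n * K) + 1)\<^sup>2"
proof -
  let ?V = "tree_vertices n" and ?E = "tree_edges n"
  have G: "graph ?V ?E" by (rule graph_tree[OF assms(1)])
  have fin: "finite ?V" and EV: "?E \<subseteq> two_subsets ?V"
    using G by (auto simp: graph_def)
  obtain p where p: "nvd ?V p" "re ?V ?E = dist_ratio ?V ?E p"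
    using re_attained[OF G] by blast
  define m where "m = Min (pair_dists p (two_subsets ?V))"
  define D where "D = Max (pair_dists p ?E)"
  have m: "0 < m" unfolding m_def by (rule Min_pair_dists_pos[OF G p(1)])
  have D: "0 \<le> D" unfolding D_def by (rule Max_pair_dists_nonneg[OF G])
  have "2 * (D / m) \<le> real K"
    using assms(2) by (simp add: p(2) dist_ratio_def m_def D_def)
  then have Dm: "2 * D \<le> real K * m"
    using m by (simp add: divide_le_eq)
  have "card ?V \<le> (2 * (n * K) + 1)\<^sup>2"
  proof (rule card_separated_le[OF m])
    fix u v assume "u \<in> ?V" "v \<in> ?V" "u \<noteq> v"
    then show "m \<le> dist (p u) (p v)"
      unfolding m_def
      by (intro Min_le finite_pair_dists[OF fin])
        (auto simp: pair_dists_def intro: doubleton_two_subsets[THEN iffD2])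
  next
    fix v assume "v \<in> ?V"
    have "dist (p k) (p (k div 2)) \<le> D" if "2 \<le> k" "k < 2 ^ n" for k
    proof -
      have "{k, k div 2} \<in> ?E" using that by (auto simp: tree_edges_def)
      then have "dist (p k) (p (k div 2)) \<in> pair_dists p ?E"
        unfolding pair_dists_def by blast
      then show ?thesis
        unfolding D_def by (intro Max_ge finite_pair_dists[OF fin EV])
    qed
    then have "dist (p v) (p 1) \<le> real (n - 1) * D"
      by (rule tree_dist_root_le) (use \<open>v \<in> ?V\<close> in \<open>auto simp: tree_vertices_def\<close>)
    also have "\<dots> \<le> real n * D"
      using D by (intro mult_right_mono) auto
    finally have "2 * dist (p v) (p 1) \<le> real n * (2 * D)" by simp
    also have "\<dots> \<le> real n * (real K * m)"
      using Dm by (intro mult_left_mono) auto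
    finally show "2 * dist (p v) (p 1) \<le> real (n * K) * m" by (simp add: mult.assoc)
  qed
  then show ?thesis by (simp add: tree_vertices_def)
qed

text \<open>Taking \<open>n = 2 * j\<close> makes both powers squares, so it suffices that
  \<open>2 ^ j\<close> exceeds a linear function of \<open>j\<close>.\<close>

lemma quadratic_less_two_power: "\<exists>n\<ge>2. (2 * (n * K) + 1)\<^sup>2 < (2::nat) ^ n - 1"
proof -
  have "(\<lambda>j. real j * (1 / 2) ^ j) \<longlonglongrightarrow> 0"
    using powser_times_n_limit_0[of "1 / 2 :: real"] by simp
  \<comment> \<open>The threshold is chosen so that \<open>j * (4 * K + 2) < 2 ^ j\<close>, which
    dominates \<open>4 * j * K + 2\<close> once \<open>1 \<le> j\<close>.\<close>
  then have "eventually (\<lambda>j. real j * (1 / 2) ^ j < 1 / (4 * real K + 2)) sequentially"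
    by (rule order_tendstoD) auto
  then have "eventually (\<lambda>j. real j * (1 / 2) ^ j < 1 / (4 * real K + 2) \<and> 1 \<le> j) sequentially"
    using eventually_ge_at_top by (rule eventually_conj)
  then obtain j where j: "real j * (1 / 2) ^ j < 1 / (4 * real K + 2)" "1 \<le> j"
    using eventually_happens' sequentially_bot by blast
  have "real (j * (4 * K + 2)) < real (2 ^ j)"
    using j(1) by (simp add: field_simps)
  then have "j * (4 * K + 2) < 2 ^ j" by (simp only: of_nat_less_iff)
  define a where "a = 2 * (2 * j * K) + 1"
  have "a + 1 \<le> j * (4 * K + 2)"
    using \<open>1 \<le> j\<close> by (simp add: a_def algebra_simps)
  then have "a + 1 \<le> 2 ^ j"
    using \<open>j * (4 * K + 2) < 2 ^ j\<close> by linarith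
  \<comment> \<open>The gap \<open>2 * a + 1\<close> between consecutive squares absorbs the
    \<open>- 1\<close> on the right of the claim.\<close>
  then have "(a + 1)\<^sup>2 \<le> (2 ^ j)\<^sup>2" by (rule power_mono) simp
  moreover have "(2 ^ j)\<^sup>2 = (2::nat) ^ (2 * j)"
    by (simp add: power_mult[symmetric] mult.commute)
  moreover have "(a + 1)\<^sup>2 = a\<^sup>2 + 2 * a + 1" by (simp add: power2_eq_square)
  moreover have "1 \<le> a" by (simp add: a_def)
  ultimately have "a\<^sup>2 < 2 ^ (2 * j) - 1" by linarith
  then show ?thesis
    using \<open>1 \<le> j\<close> by (intro exI[of _ "2 * j"]) (simp add: a_def)
qed

theorem theorem5:
  fixes R :: real
  assumes "R > 0"
  shows "\<exists>(V :: nat set) E. graph V E \<and> max_degree V E \<le> 3 \<and> re V E > R"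
proof -
  \<comment> \<open>Rounding up makes the radius in the packing bound a natural number.\<close>
  define K where "K = nat \<lceil>2 * R\<rceil>"
  have K: "2 * R \<le> real K" unfolding K_def by (rule real_nat_ceiling_ge)
  obtain n where n: "2 \<le> n" "(2 * (n * K) + 1)\<^sup>2 < (2::nat) ^ n - 1"
    using quadratic_less_two_power by blast
  have "re (tree_vertices n) (tree_edges n) > R"
  proof (rule ccontr)
    assume "\<not> re (tree_vertices n) (tree_edges n) > R"
    then have "2 * re (tree_vertices n) (tree_edges n) \<le> real K"
      using K by linarith
    from re_tree_card_bound[OF n(1) this] show False
      using n(2) by linarith
  qed
  then show ?thesis using graph_tree[OF n(1)] max_degree_tree_le[OF n(1)] by blast
qed

end
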